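(* Let $w \in \{1,2,\dots,k\}^{\mathbb{Z}}$ and $S \subseteq \mathbb{Z}_{\geq 0}$. Then $h(X_w(S)) = \log\lambda$, where $\lambda>0$ is the unique positive solution to $$1=\sum_{n\in S}\phi_w(n)\,\lambda^{-(n+1)}.$$
   Context: Here $k>0$ is an integer. A word over an alphabet is a finite sequence of letters; $|u|$ denotes the length of the word $u$, and $\epsilon$ is the empty word, with $|\epsilon|=0$. A nonempty word $u$ appears in a bi-infinite sequence $x=(x_i)_{i\in\mathbb{Z}}$ if $u=x_ix_{i+1}\cdots x_j$ for some integers $i\le j$; the empty word is regarded as appearing in every sequence. For $w\in\{1,\dots,k\}^{\mathbb{Z}}$ and $n\ge 0$, the complexity function $\phi_w(n)$ is the number of distinct words of length $n$ appearing in $w$ (so $\phi_w(0)=1$). The $(S,w)$-gap shift is $$X_w(S)=\overline{\{\ldots 0\,u_{-1}\,0\,u_0\,0\,u_1\,0\ldots : u_i \text{ appears in } w,\ |u_i|\in S \text{ for all } i\in\mathbb{Z}\}}\subseteq\{0,1,\dots,k\}^{\mathbb{Z}},$$ i.e. the closure (in the product topology of the discrete topology) of the set of all bi-infinite concatenations, positioned arbitrarily, in which consecutive $0$'s are separated by words $u_i$ appearing in $w$ with $|u_i|\in S$ (the words $u_i$ may be chosen freely and independently). For a shift space $X$, $\mathcal{B}_n(X)$ is the set of words of length $n$ appearing in some point of $X$, and the (topological) entropy is $h(X)=\lim_{n\to\infty}\frac1n\log|\mathcal{B}_n(X)|$ (natural logarithm). *)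

theory Defs
  imports "HOL-Analysis.Analysis"
begin

(* For j < i the interval [i..j] is empty, so the empty word appears in every sequence. *)
definition appears :: "nat list \<Rightarrow> (int \<Rightarrow> nat) \<Rightarrow> bool" where
  "appears u x \<longleftrightarrow> (\<exists>i j. u = map x [i..j])"

definition complexity :: "(int \<Rightarrow> nat) \<Rightarrow> nat \<Rightarrow> nat" where
  "complexity w n = card {u. length u = n \<and> appears u w}"

(* p i is the position of the zero preceding the word u i.  The equation forces
   p (i + 1) = p i + 1 + length (u i), so the blocks 0 # u i tile all of the integers. *)
definition gap_concatenations :: "(int \<Rightarrow> nat) \<Rightarrow> nat set \<Rightarrow> (int \<Rightarrow> nat) set" where
  "gap_concatenations w S =
     {x. \<exists>(u :: int \<Rightarrow> nat list) (p :: int \<Rightarrow> int). \<forall>i.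
           appears (u i) w \<and> length (u i) \<in> S \<and>
           map x [p i..p (i + 1) - 1] = 0 # u i}"

(* The closure is taken in the product topology on int \<Rightarrow> nat, where nat is discrete.
   It agrees with the closure in {0..k}^Z whenever w takes values in {1..k}, since {0..k}^Z
   is then a closed set containing the concatenations. *)
definition gap_shift :: "(int \<Rightarrow> nat) \<Rightarrow> nat set \<Rightarrow> (int \<Rightarrow> nat) set" where
  "gap_shift w S = closure (gap_concatenations w S)"

definition language :: "nat \<Rightarrow> (int \<Rightarrow> nat) set \<Rightarrow> nat list set" where
  "language n X = {u. length u = n \<and> (\<exists>x\<in>X. appears u x)}"

(* h(X) = h, including the existence of the limit that defines h(X). *)
definition has_entropy :: "(int \<Rightarrow> nat) set \<Rightarrow> real \<Rightarrow> bool" where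
  "has_entropy X h \<longleftrightarrow> (\<lambda>n. ln (real (card (language n X))) / real n) \<longlonglongrightarrow> h"

end

theory Submission
  imports Defs "HOL-Real_Asymp.Real_Asymp"
begin

text \<open>Words of length \<open>n\<close> that are concatenations of blocks \<open>0 # u\<close> decompose uniquely, so after
  weighting by \<open>\<lambda>\<^sup>-\<^sup>n\<close> their numbers satisfy a renewal equation whose step weights sum to 1. Hence
  they are at most 1, but not summable. Since every word of the shift is a piece of a block, then
  complete blocks, then a piece of a block, the upper bound gives
  \<open>card (language n X) \<le> poly(n) * \<lambda>\<^sup>n\<close>. In the other direction, submultiplicativity of the language
  (Fekete) makes the entropy limit exist, and a limit below \<open>ln \<lambda>\<close> would make the weighted numbers
  summable. A solution \<open>\<lambda>\<close> exists because submultiplicativity of the complexity forces the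
  series to diverge at its radius of convergence when \<open>S\<close> is infinite.\<close>

section \<open>Growth rates of submultiplicative sequences\<close>

text \<open>Fekete's lemma, with \<open>H\<close> the exponential of the infimum of
  \<open>ln (b n) / n\<close>. Besides the limit it delivers two exponential bounds valid for every
  \<open>n\<close>, which the counting arguments use.\<close>

lemma submultiplicative_growth:
  fixes b :: "nat \<Rightarrow> real"
  assumes ge1: "\<And>n. b n \<ge> 1" and sub: "\<And>m n. b (m + n) \<le> b m * b n"
  obtains H where "H \<ge> 1" "(\<lambda>n. ln (b n) / real n) \<longlonglongrightarrow> ln H"
    "\<And>n. H ^ n \<le> b n" "\<And>r. r > H \<Longrightarrow> \<exists>C>0. \<forall>n. b n \<le> C * r ^ n"
proof -
  have pos: "b n > 0" for n using ge1[of n] by linarith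
  \<comment> \<open>Index 0 is left out: division by zero gives 0 there, which would force the
    infimum to be 0.\<close>
  define A where "A = (\<lambda>n. ln (b n) / real n) ` {1..}"
  define L where "L = Inf A"
  have A_ne: "A \<noteq> {}" by (auto simp: A_def)
  have A_nonneg: "0 \<le> a" if "a \<in> A" for a using that ge1 by (auto simp: A_def)
  have A_bdd: "bdd_below A" using A_nonneg by (auto simp: bdd_below_def)
  have L0: "L \<ge> 0" unfolding L_def by (rule cInf_greatest[OF A_ne A_nonneg])
  have L_le: "L \<le> ln (b n) / real n" if "n > 0" for n
    unfolding L_def by (rule cInf_lower[OF _ A_bdd]) (use that in \<open>auto simp: A_def\<close>)
  have lower: "exp L ^ n \<le> b n" for n
  proof (cases "n = 0")
    case False
    then have "real n * L \<le> ln (b n)" using L_le[of n] by (simp add: field_simps)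
    then have "exp (real n * L) \<le> b n" using pos by (simp add: ln_ge_iff)
    then show ?thesis by (simp add: exp_of_nat_mult)
  qed (use ge1 in simp)
  have upper: "\<exists>C>0. \<forall>n. b n \<le> C * r ^ n" if r: "r > exp L" for r
  proof -
    have r0: "r > 0" using r by (meson exp_gt_zero less_trans)
    then have "L < ln r" using r ln_ge_iff[of r L] by (smt (verit) exp_ln exp_less_cancel_iff)
    then obtain a where "a \<in> A" "a < ln r"
      using cInf_lessD[OF A_ne] by (auto simp: L_def)
    then obtain m where m: "m \<ge> 1" "ln (b m) / real m < ln r" by (auto simp: A_def)
    then have "ln (b m) < real m * ln r" by (simp add: field_simps)
    then have bm: "b m \<le> r ^ m" using pos[of m] r0
      by (smt (verit) ln_realpow ln_less_cancel_iff zero_less_power)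
    have bq: "b (q * m + s) \<le> (r ^ m) ^ q * b s" for q s
    proof (induction q)
      case (Suc q)
      have "b (Suc q * m + s) \<le> b m * b (q * m + s)" using sub[of m "q * m + s"] by (simp add: add.assoc)
      also have "\<dots> \<le> r ^ m * ((r ^ m) ^ q * b s)"
        using Suc bm pos r0 by (intro mult_mono) (auto intro: less_imp_le)
      finally show ?case by (simp add: mult.assoc)
    qed simp
    \<comment> \<open>Summing nonnegative terms over all remainders modulo \<open>m\<close> yields
      one constant that serves each of them.\<close>
    define C where "C = (\<Sum>s<m. b s / r ^ s)"
    have C: "b s \<le> C * r ^ s" if "s < m" for s
    proof -
      have "b s / r ^ s \<le> C" unfolding C_def
        by (rule member_le_sum) (use that pos r0 in \<open>auto intro: less_imp_le\<close>)
      then show ?thesis using r0 by (simp add: field_simps)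
    qed
    have "b 0 \<le> C" using C[of 0] m by simp
    then have "C > 0" using pos[of 0] by linarith
    moreover have "b n \<le> C * r ^ n" for n
    proof -
      have "b n \<le> (r ^ m) ^ (n div m) * b (n mod m)" using bq[of "n div m" "n mod m"] by simp
      also have "\<dots> \<le> (r ^ m) ^ (n div m) * (C * r ^ (n mod m))"
        using C[of "n mod m"] m r0 by (intro mult_left_mono) auto
      also have "\<dots> = C * r ^ (m * (n div m) + n mod m)" by (simp add: mult.left_commute flip: power_mult power_add)
      finally show ?thesis by (simp del: power_mult power_add)
    qed
    ultimately show ?thesis by blast
  qed
  have lim: "(\<lambda>n. ln (b n) / real n) \<longlonglongrightarrow> L"
  proof (rule tendstoI)
    fix e :: real assume e: "e > 0"
    \<comment> \<open>Half of \<open>e\<close> goes into the exponential rate; the other half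
      absorbs \<open>ln C / n\<close> for large \<open>n\<close>.\<close>
    obtain C where C: "C > 0" "\<And>n. b n \<le> C * exp (L + e / 2) ^ n"
      using upper[of "exp (L + e / 2)"] e by auto
    have "(\<lambda>n. ln C / real n) \<longlonglongrightarrow> 0" by real_asymp
    then have "\<forall>\<^sub>F n in sequentially. ln C / real n < e / 2"
      using e by (intro order_tendstoD(2)[of _ 0]) auto
    then show "\<forall>\<^sub>F n in sequentially. dist (ln (b n) / real n) L < e"
      using eventually_gt_at_top[of 0]
    proof eventually_elim
      case (elim n)
      have "ln (b n) \<le> ln (C * exp (L + e / 2) ^ n)" using C pos by simp
      also have "\<dots> = ln C + real n * (L + e / 2)" using C(1) by (simp add: ln_mult ln_realpow)
      finally have "ln (b n) / real n \<le> ln C / real n + (L + e / 2)"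
        using elim(2) by (simp add: field_simps)
      then have "ln (b n) / real n < L + e" using elim(1) by linarith
      then show ?case using elim(2) L_le[of n] e by (simp add: dist_real_def abs_less_iff)
    qed
  qed
  show ?thesis
    by (rule that[of "exp L"]) (use L0 lim lower upper in auto)
qed

section \<open>Words appearing in a sequence, and languages\<close>

lemma upto_split_at:
  assumes "i \<le> m" "m \<le> j + 1"
  shows "[i..j] = [i..m - 1] @ [m..j]"
  using assms upto_split1[of i m j] by (cases "m = j + 1") auto

lemma appears_Nil [simp]: "appears [] x"
  unfolding appears_def by (rule exI[of _ 1], rule exI[of _ 0]) simp

lemma appears_append:
  assumes "appears (u @ v) x"
  shows "appears u x" "appears v x"
proof -
  have "appears u x \<and> appears v x"
  proof (cases "u @ v = []")
    \<comment> \<open>The empty word is set apart because its endpoints \<open>i > j\<close> are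
      arbitrary, so that \<open>m = i\<close> could exceed \<open>j + 1\<close>.\<close>
    case False
    obtain i j where ij: "u @ v = map x [i..j]" using assms by (auto simp: appears_def)
    define m where "m = i + int (length u)"
    have "length u + length v = nat (j - i + 1)" using arg_cong[OF ij, of length] by simp
    moreover have "length u + length v > 0" using False by auto
    ultimately have m: "i \<le> m" "m \<le> j + 1" unfolding m_def by linarith+
    have "u @ v = map x [i..m - 1] @ map x [m..j]"
      using ij upto_split_at[OF m] by simp
    moreover have "length u = length (map x [i..m - 1])" by (simp add: m_def)
    ultimately have "u = map x [i..m - 1] \<and> v = map x [m..j]"
      by (metis append_eq_append_conv)
    then show ?thesis unfolding appears_def by blast
  qed simp
  then show "appears u x" "appears v x" by auto
qed

lemma appears_imp_set_subset: "appears u x \<Longrightarrow> set u \<subseteq> range x"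
  by (auto simp: appears_def)

lemma appears_ex_length: "\<exists>u. length u = n \<and> appears u x"
  unfolding appears_def by (intro exI[of _ "map x [1..int n]"]) auto

lemma language_nonempty: "X \<noteq> {} \<Longrightarrow> language n X \<noteq> {}"
  unfolding language_def using appears_ex_length[of n] by blast

lemma finite_language:
  assumes "finite A" "\<And>x. x \<in> X \<Longrightarrow> range x \<subseteq> A"
  shows "finite (language n X)"
proof (rule finite_subset[OF _ finite_lists_length_eq[OF assms(1)]])
  show "language n X \<subseteq> {xs. set xs \<subseteq> A \<and> length xs = n}"
    unfolding language_def using assms(2) appears_imp_set_subset by blast
qed

text \<open>Cut after \<open>m\<close> letters: both halves appear in the same point, so every
  longer word is a concatenation of one word from each language.\<close>

lemma card_language_add_le:
  assumes "\<And>n. finite (language n X)"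
  shows "card (language (m + n) X) \<le> card (language m X) * card (language n X)"
proof -
  have "language (m + n) X \<subseteq> (\<lambda>(u, v). u @ v) ` (language m X \<times> language n X)"
  proof
    fix u assume u: "u \<in> language (m + n) X"
    then obtain x where x: "x \<in> X" "appears (take m u @ drop m u) x" by (auto simp: language_def)
    then have "take m u \<in> language m X" "drop m u \<in> language n X"
      using u appears_append[OF x(2)] by (auto simp: language_def)
    then show "u \<in> (\<lambda>(u, v). u @ v) ` (language m X \<times> language n X)"
      by (intro image_eqI[of _ _ "(take m u, drop m u)"]) auto
  qed
  then have "card (language (m + n) X) \<le> card (language m X \<times> language n X)"
    using assms by (intro surj_card_le) auto
  then show ?thesis by (simp add: card_cartesian_product)
qed

text \<open>Applied to \<open>{w}\<close>, whose language counts are the complexity, and to the set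
  of gap concatenations.\<close>

lemma language_growth:
  assumes fin: "\<And>n. finite (language n X)" and ne: "X \<noteq> {}"
  obtains H where "H \<ge> 1" "has_entropy X (ln H)"
    "\<And>n. H ^ n \<le> real (card (language n X))"
    "\<And>r. r > H \<Longrightarrow> \<exists>C>0. \<forall>n. real (card (language n X)) \<le> C * r ^ n"
proof -
  let ?b = "\<lambda>n. real (card (language n X))"
  have "1 \<le> ?b n" for n
    using fin[of n] language_nonempty[OF ne, of n] by (simp add: Suc_le_eq card_gt_0_iff)
  moreover have "?b (m + n) \<le> ?b m * ?b n" for m n
    using card_language_add_le[of X m n] fin by (metis of_nat_le_iff of_nat_mult)
  ultimately obtain H where "H \<ge> 1" "(\<lambda>n. ln (?b n) / real n) \<longlonglongrightarrow> ln H"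
    "\<And>n. H ^ n \<le> ?b n" "\<And>r. r > H \<Longrightarrow> \<exists>C>0. \<forall>n. ?b n \<le> C * r ^ n"
    using submultiplicative_growth[of ?b] by blast
  then show ?thesis using that unfolding has_entropy_def by blast
qed

lemma complexity_eq_card_language: "complexity w n = card (language n {w})"
  by (simp add: complexity_def language_def)

section \<open>Finite concatenations of blocks and their numbers\<close>

text \<open>Each block carries its zero in front, as in \<open>gap_concatenations\<close>, so the
  windows between two of the positions \<open>p i\<close> are block words.\<close>

inductive_set block_words :: "(int \<Rightarrow> nat) \<Rightarrow> nat set \<Rightarrow> nat list set" for w S where
  Nil: "[] \<in> block_words w S"
| Cons: "appears u w \<Longrightarrow> length u \<in> S \<Longrightarrow> v \<in> block_words w S \<Longrightarrow> 0 # u @ v \<in> block_words w S"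

definition block_words_len :: "(int \<Rightarrow> nat) \<Rightarrow> nat set \<Rightarrow> nat \<Rightarrow> nat list set" where
  "block_words_len w S n = {v \<in> block_words w S. length v = n}"

lemma block_words_hd: "v \<in> block_words w S \<Longrightarrow> v = [] \<or> hd v = 0"
  by (induction rule: block_words.induct) auto

lemma block_words_set: "v \<in> block_words w S \<Longrightarrow> set v \<subseteq> insert 0 (range w)"
  by (induction rule: block_words.induct) (auto dest: appears_imp_set_subset)

lemma block_words_len_0: "block_words_len w S 0 = {[]}"
  by (auto simp: block_words_len_def intro: block_words.Nil)

lemma finite_block_words_len:
  assumes "finite (range w)"
  shows "finite (block_words_len w S n)"
proof (rule finite_subset[OF _ finite_lists_length_eq])
  show "block_words_len w S n \<subseteq> {v. set v \<subseteq> insert 0 (range w) \<and> length v = n}"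
    by (auto simp: block_words_len_def dest: block_words_set[THEN subsetD])
qed (use assms in simp)

text \<open>Split off the first block: with a gap word of length \<open>n\<close> it takes
  \<open>n + 1\<close> letters, which leaves \<open>N - n\<close>.\<close>

lemma block_words_len_Suc:
  "block_words_len w S (Suc N) =
   (\<lambda>(n, u, v). 0 # u @ v) ` (SIGMA n:{n\<in>S. n \<le> N}. language n {w} \<times> block_words_len w S (N - n))"
  (is "_ = ?f ` ?D")
proof
  show "block_words_len w S (Suc N) \<subseteq> ?f ` ?D"
  proof
    fix q assume "q \<in> block_words_len w S (Suc N)"
    then have "q \<in> block_words w S" "length q = Suc N" by (auto simp: block_words_len_def)
    then show "q \<in> ?f ` ?D"
    proof (cases rule: block_words.cases)
      case (Cons u v)
      then show ?thesis using \<open>length q = Suc N\<close>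
        by (intro image_eqI[of _ _ "(length u, u, v)"]) (auto simp: language_def block_words_len_def)
    qed simp
  qed
  show "?f ` ?D \<subseteq> block_words_len w S (Suc N)"
    by (auto simp: language_def block_words_len_def intro: block_words.Cons)
qed

text \<open>The letters of \<open>w\<close> are nonzero, so the zeros of a block word determine its blocks.\<close>

lemma card_block_words_len_Suc:
  assumes fin: "finite (range w)" and nz: "0 \<notin> range w"
  shows "card (block_words_len w S (Suc N)) =
    (\<Sum>n\<in>{n\<in>S. n \<le> N}. complexity w n * card (block_words_len w S (N - n)))"
proof -
  let ?D = "SIGMA n:{n\<in>S. n \<le> N}. language n {w} \<times> block_words_len w S (N - n)"
  have tw: "takeWhile (\<lambda>a. a \<noteq> 0) (u @ v) = u"
    if "u \<in> language n {w}" "v \<in> block_words_len w S m" for u v n m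
  proof -
    have "\<forall>a\<in>set u. a \<noteq> 0" using that(1) nz appears_imp_set_subset by (fastforce simp: language_def)
    moreover have "takeWhile (\<lambda>a. a \<noteq> 0) v = []"
      using block_words_hd[of v w S] that(2) by (cases v) (auto simp: block_words_len_def)
    ultimately show ?thesis by (simp add: takeWhile_append2)
  qed
  have "inj_on (\<lambda>(n, u, v). 0 # u @ v) ?D"
  proof (rule inj_onI, clarsimp)
    fix n u v n' u' v'
    assume a: "u \<in> language n {w}" "v \<in> block_words_len w S (N - n)"
      "u' \<in> language n' {w}" "v' \<in> block_words_len w S (N - n')" and eq: "u @ v = u' @ v'"
    then have "u = u'" using tw by metis
    then show "n = n' \<and> u = u' \<and> v = v'" using a eq by (auto simp: language_def)
  qed
  then have "card (block_words_len w S (Suc N)) = card ?D"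
    by (simp add: block_words_len_Suc card_image)
  also have "\<dots> = (\<Sum>n\<in>{n\<in>S. n \<le> N}. card (language n {w} \<times> block_words_len w S (N - n)))"
    using finite_language[of "range w" "{w}"] finite_block_words_len[OF fin] fin
    by (intro card_SigmaI) auto
  finally show ?thesis by (simp add: card_cartesian_product complexity_eq_card_language)
qed

section \<open>The entropy equation: existence and uniqueness of the solution\<close>

text \<open>Passing to the reciprocal turns the equation into a power series in \<open>1 / m\<close>
  with coefficients zero outside \<open>S\<close>. As the terms are nonnegative, unordered sum and
  series agree.\<close>

lemma has_sum_iff_sums_powers:
  fixes a :: "nat \<Rightarrow> real"
  assumes "\<And>n. a n \<ge> 0" "m > 0"
  shows "((\<lambda>n. a n * m powi (- (int n + 1))) has_sum 1) S \<longleftrightarrow>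
    (\<lambda>n. (if n \<in> S then a n else 0) * (1 / m) ^ Suc n) sums 1"
proof -
  let ?f = "\<lambda>n. (if n \<in> S then a n else 0) * (1 / m) ^ Suc n"
  have "m powi (- (int n + 1)) = (1 / m) ^ Suc n" for n
    using power_int_minus[of m "int (Suc n)"] unfolding power_int_of_nat
    by (simp add: power_one_over inverse_eq_divide add.commute)
  then have "((\<lambda>n. a n * m powi (- (int n + 1))) has_sum 1) S \<longleftrightarrow> (?f has_sum 1) UNIV"
    by (intro has_sum_cong_neutral) auto
  also have "\<dots> \<longleftrightarrow> ?f sums 1"
  proof
    have "?f n \<ge> 0" for n using assms by simp
    then show "(?f has_sum 1) UNIV" if "?f sums 1"
      using that by (intro sums_nonneg_imp_has_sum)
  qed (rule has_sum_imp_sums)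
  finally show ?thesis .
qed

text \<open>One positive coefficient makes the power series strictly increasing on the nonnegative
  axis. Taken with \<open>s = t = 1\<close>, this gives uniqueness of the solution.\<close>

lemma sums_powers_inj:
  fixes a :: "nat \<Rightarrow> real"
  assumes a: "\<And>n. a n \<ge> 0" "a j > 0" and z: "0 \<le> y" "y < z"
    and s: "(\<lambda>n. a n * y ^ Suc n) sums s" "(\<lambda>n. a n * z ^ Suc n) sums t"
  shows "s < t"
proof -
  have le: "a n * y ^ Suc n \<le> a n * z ^ Suc n" for n
    using a(1) z by (intro mult_left_mono power_mono) auto
  have "a j * y ^ Suc j < a j * z ^ Suc j"
    using a(2) z by (intro mult_strict_left_mono power_strict_mono) auto
  moreover have "(\<lambda>n. a n * z ^ Suc n - a n * y ^ Suc n) sums (t - s)"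
    using s by (intro sums_diff)
  ultimately have "0 < t - s"
    using le suminf_pos2[of "\<lambda>n. a n * z ^ Suc n - a n * y ^ Suc n" j]
    by (simp add: sums_iff)
  then show ?thesis by simp
qed

text \<open>Intermediate value theorem on \<open>{0..z}\<close>; convergence at some
  \<open>K > z\<close> makes the series continuous up to and including \<open>z\<close>.\<close>

lemma powers_sums_one:
  fixes a :: "nat \<Rightarrow> real"
  assumes z: "0 < z" "z < K" and summ: "summable (\<lambda>n. a n * K ^ n)"
    and ge: "(\<Sum>n. a n * z ^ n) * z \<ge> 1"
  obtains y where "0 < y" "y \<le> z" "(\<lambda>n. a n * y ^ Suc n) sums 1"
proof -
  let ?g = "\<lambda>y. (\<Sum>n. a n * y ^ n) * y"
  have "continuous_on {0..z} ?g"
    using z by (intro continuous_at_imp_continuous_on ballI continuous_mult continuous_ident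
        isCont_powser[OF summ]) auto
  then obtain y where y: "0 \<le> y" "y \<le> z" "?g y = 1"
    using IVT'[of ?g 0 1 z] ge z by auto
  have "summable (\<lambda>n. a n * y ^ n)"
    using powser_inside[OF summ, of y] y z by auto
  then have "(\<lambda>n. a n * y ^ n * y) sums ?g y"
    by (intro sums_mult2 summable_sums)
  moreover have "y > 0" using y by (cases "y = 0") auto
  ultimately show ?thesis using y that[of y] by (simp add: mult_ac)
qed

text \<open>For finite \<open>S\<close> the series is a polynomial whose value at 1 is at least
  \<open>b j\<close> for any \<open>j\<close> in \<open>S\<close>. For infinite \<open>S\<close> the
  bound \<open>G ^ n \<le> b n\<close> lifts the sum above 1 already below \<open>1 / G\<close>, so
  the solution satisfies \<open>G * z < 1\<close>. This inequality later controls the pieces of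
  arbitrarily long blocks.\<close>

lemma entropy_equation_solvable:
  fixes b :: "nat \<Rightarrow> real"
  assumes S: "S \<noteq> {}" and b1: "\<And>n. b n \<ge> 1"
    and G: "G \<ge> 1" "\<And>n. G ^ n \<le> b n" "\<And>r. r > G \<Longrightarrow> \<exists>C>0. \<forall>n. b n \<le> C * r ^ n"
  obtains z where "0 < z" "infinite S \<Longrightarrow> G * z < 1"
    "(\<lambda>n. (if n \<in> S then b n else 0) * z ^ Suc n) sums 1"
proof -
  let ?a = "\<lambda>n. if n \<in> S then b n else 0"
  have a0: "?a n \<ge> 0" for n using b1[of n] by auto
  show ?thesis
  proof (cases "finite S")
    case True
    have summ: "summable (\<lambda>n. ?a n * K ^ n)" for K
      by (rule summable_finite[OF True]) auto
    obtain j where j: "j \<in> S" using S by auto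
    have "1 \<le> ?a j" using j b1 by auto
    also have "\<dots> \<le> (\<Sum>n. ?a n)"
      using sum_le_suminf[of ?a "{j}"] summ[of 1] a0 by (simp del: if_split)
    finally obtain y where "0 < y" "(\<lambda>n. ?a n * y ^ Suc n) sums 1"
      using powers_sums_one[of 1 2 ?a] summ[of 2] by auto
    then show ?thesis using that True by blast
  next
    case False
    have summ: "summable (\<lambda>n. ?a n * K ^ n)" if K: "0 < K" "G * K < 1" for K
    proof -
      obtain r where r: "G < r" "r < 1 / K" using K dense[of G "1 / K"] by (auto simp: field_simps)
      obtain C where C: "C > 0" "\<And>n. b n \<le> C * r ^ n" using G(3)[OF r(1)] by auto
      have "\<bar>r * K\<bar> < 1" using r K G(1) by (auto simp: field_simps abs_mult)
      then have "summable (\<lambda>n. C * (r * K) ^ n)" by (intro summable_mult summable_geometric) simp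
      then show ?thesis
      proof (rule summable_comparison_test')
        fix n
        have "?a n \<le> C * r ^ n" using b1[of n] C(2)[of n] C(1) r G(1) by auto
        then have "?a n * K ^ n \<le> C * r ^ n * K ^ n" using K by (intro mult_right_mono) auto
        then show "norm (?a n * K ^ n) \<le> C * (r * K) ^ n"
          using a0[of n] K by (simp add: power_mult_distrib mult.assoc)
      qed
    qed
    \<comment> \<open>At \<open>1 / G\<close> each term \<open>G ^ n * z ^ Suc n\<close> equals
      \<open>1 / G\<close>, so more than \<open>G\<close> indices from \<open>S\<close> push the sum
      beyond 1. A finite sum is continuous, hence this persists slightly to the left of
      \<open>1 / G\<close>, where the whole series converges.\<close>
    obtain N :: nat where N: "real N > G" using reals_Archimedean2 by blast
    obtain F where F: "F \<subseteq> S" "finite F" "card F = N"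
      using infinite_arbitrarily_large[OF False] by blast
    define p where "p z = (\<Sum>n\<in>F. G ^ n * z ^ Suc n)" for z
    have "p (1 / G) = real N / G"
      using G(1) F by (simp add: p_def power_divide)
    moreover have "real N / G > 1" using N G(1) by simp
    ultimately have "p (1 / G) > 1" by simp
    moreover have "(p \<longlongrightarrow> p (1 / G)) (at_left (1 / G))"
      unfolding p_def by (intro tendsto_intros)
    ultimately have "\<forall>\<^sub>F z in at_left (1 / G). p z > 1"
      by (intro order_tendstoD(1))
    moreover have "\<forall>\<^sub>F z in at_left (1 / G). z > 0 \<and> z < 1 / G"
      using eventually_at_left_real[of 0 "1 / G"] G(1) by simp
    ultimately have "\<forall>\<^sub>F z in at_left (1 / G). p z > 1 \<and> 0 < z \<and> z < 1 / G"
      by eventually_elim auto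
    then obtain z where z: "p z > 1" "0 < z" "z < 1 / G"
      using eventually_happens'[OF trivial_limit_at_left_real] by blast
    \<comment> \<open>\<open>K\<close> lies strictly between \<open>z\<close> and
      \<open>1 / G\<close>, so that the series is continuous on all of
      \<open>{0..z}\<close>.\<close>
    obtain K where K: "z < K" "K < 1 / G" using dense[OF z(3)] by blast
    have GK: "G * K < 1" "G * z < 1" using K z G(1) by (auto simp: field_simps)
    have "p z \<le> (\<Sum>n\<in>F. ?a n * z ^ n * z)"
      unfolding p_def
    proof (rule sum_mono)
      fix n assume "n \<in> F"
      then have "G ^ n * (z ^ n * z) \<le> ?a n * (z ^ n * z)"
        using F(1) G(2)[of n] z(2) by (intro mult_right_mono) auto
      then show "G ^ n * z ^ Suc n \<le> ?a n * z ^ n * z" by (simp only: power_Suc2 mult.assoc)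
    qed
    also have "\<dots> \<le> (\<Sum>n. ?a n * z ^ n) * z"
      unfolding sum_distrib_right[symmetric]
      using F z a0 GK by (intro mult_right_mono sum_le_suminf summ) auto
    finally have "1 \<le> (\<Sum>n. ?a n * z ^ n) * z" using z by linarith
    moreover have "summable (\<lambda>n. ?a n * K ^ n)" using summ[of K] z K GK by simp
    ultimately obtain y where y: "0 < y" "y \<le> z" "(\<lambda>n. ?a n * y ^ Suc n) sums 1"
      using powers_sums_one[of z K ?a, OF z(2) K(1)] by blast
    have "G * y \<le> G * z" using y G(1) by simp
    then show ?thesis using that y GK by force
  qed
qed

section \<open>The language of the shift and the factors of block words\<close>

text \<open>Fixing finitely many coordinates is an open condition, so each window of a limit point
  already occurs in \<open>X\<close>. The entropy can therefore be computed without the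
  closure.\<close>

lemma language_closure:
  fixes X :: "(int \<Rightarrow> nat) set"
  shows "language n (closure X) = language n X"
proof
  show "language n X \<subseteq> language n (closure X)"
    using closure_subset[of X] by (auto simp: language_def)
  show "language n (closure X) \<subseteq> language n X"
  proof
    fix z assume "z \<in> language n (closure X)"
    then obtain x i j where x: "x \<in> closure X" "z = map x [i..j]" "length z = n"
      by (auto simp: language_def appears_def)
    let ?U = "{y. \<forall>t\<in>{i..j}. y t \<in> {x t}}"
    have "open ?U"
      by (rule product_topology_basis'[of "{i..j}" "\<lambda>t. {x t}" "\<lambda>t. t"]) (auto intro: open_discrete)
    moreover have "x \<in> ?U \<inter> closure X" using x by simp
    ultimately obtain y where y: "y \<in> X" "y \<in> ?U"
      using open_Int_closure_eq_empty[of ?U X] by blast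
    then have "z = map y [i..j]" using x by auto
    then show "z \<in> language n X"
      using x y unfolding language_def appears_def by blast
  qed
qed

lemma tiling_window_block_words:
  assumes tile: "\<And>i. appears (u i) w \<and> length (u i) \<in> S \<and> map x [p i..p (i + 1) - 1] = 0 # u i"
    and le: "\<And>i n. p i + int n \<le> p (i + int n)"
  shows "map x [p i..p (i + int n) - 1] \<in> block_words w S"
proof (induction n arbitrary: i)
  case (Suc n)
  have "p i \<le> p (i + 1)" "p (i + 1) \<le> p (i + int (Suc n))"
    using le[of i 1] le[of "i + 1" n] by (simp_all add: algebra_simps)
  then have "map x [p i..p (i + int (Suc n)) - 1]
    = map x [p i..p (i + 1) - 1] @ map x [p (i + 1)..p (i + int (Suc n)) - 1]"
    by (subst upto_split_at[of _ "p (i + 1)"]) auto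
  also have "\<dots> = 0 # u i @ map x [p (i + 1)..p (i + 1 + int n) - 1]"
    using tile[of i] by (simp add: algebra_simps)
  finally show ?case using tile[of i] Suc[of "i + 1"] by (auto intro: block_words.Cons)
qed (simp add: block_words.Nil)

lemma appears_gap_concatenations_imp_factor:
  assumes "x \<in> gap_concatenations w S" "appears z x"
  shows "\<exists>a b. a @ z @ b \<in> block_words w S"
proof (cases "z = []")
  case True
  then show ?thesis by (intro exI[of _ "[]"]) (simp add: block_words.Nil)
next
  case False
  define P where "P u p \<longleftrightarrow> (\<forall>i. appears (u i) w \<and> length (u i) \<in> S \<and>
    map x [p i..p (i + 1) - 1] = 0 # u i)" for u and p :: "int \<Rightarrow> int"
  have "\<exists>u p. P u p" using assms(1) by (simp add: gap_concatenations_def P_def)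
  then obtain u p where "P u p" by blast
  then have tile: "appears (u i) w \<and> length (u i) \<in> S \<and> map x [p i..p (i + 1) - 1] = 0 # u i" for i
    by (simp add: P_def)
  have "p i + 1 \<le> p (i + 1)" for i
  proof -
    have "length (map x [p i..p (i + 1) - 1]) = Suc (length (u i))" using tile[of i] by simp
    then show ?thesis by simp
  qed
  then have le: "p i + int n \<le> p (i + int n)" for i n
  proof (induction n)
    case (Suc n)
    from Suc.IH[OF Suc.prems] Suc.prems[of "i + int n"] show ?case by (simp add: algebra_simps)
  qed simp
  obtain s t where st: "z = map x [s..t]" using assms(2) by (auto simp: appears_def)
  with False have "s \<le> t" by auto
  \<comment> \<open>\<open>p\<close> grows by at least 1 per block, so \<open>n\<close> blocks on
    either side of \<open>p 0\<close> reach past both ends of the window; the last summand 1 makes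
    \<open>t < hi\<close> strict.\<close>
  define n where "n = nat (\<bar>s - p 0\<bar> + \<bar>t - p 0\<bar> + 1)"
  define lo hi where "lo = p (- int n)" and "hi = p (int n)"
  have "p 0 + int n \<le> hi" "lo + int n \<le> p 0"
    using le[of 0 n] le[of "- int n" n] by (simp_all add: lo_def hi_def)
  moreover have "int n = \<bar>s - p 0\<bar> + \<bar>t - p 0\<bar> + 1" by (simp add: n_def)
  ultimately have "lo \<le> s" "t < hi" by linarith+
  then have "[lo..hi - 1] = [lo..s - 1] @ [s..t] @ [t + 1..hi - 1]"
    using upto_split_at[of lo s "hi - 1"] upto_split_at[of s "t + 1" "hi - 1"] \<open>s \<le> t\<close> by simp
  moreover have "map x [lo..hi - 1] \<in> block_words w S"
    using tiling_window_block_words[OF tile le, of "- int n" "2 * n"] by (simp add: lo_def hi_def)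
  ultimately have "map x [lo..s - 1] @ z @ map x [t + 1..hi - 1] \<in> block_words w S"
    using st by simp
  then show ?thesis by blast
qed

text \<open>Partial sums of the block lengths place the blocks. Each integer then lies in exactly
  one of them, and \<open>x\<close> reads off the letter found there.\<close>

lemma ex_tiling:
  fixes u :: "int \<Rightarrow> nat list"
  obtains p x where "\<And>i. p i \<le> p (i + 1)" "\<And>i. map x [p i..p (i + 1) - 1] = 0 # u i"
proof -
  define l where "l i = 1 + int (length (u i))" for i
  \<comment> \<open>At most one of the two sums is nonempty, so this is the signed total length of
    the blocks between index 0 and index \<open>i\<close>.\<close>
  define p where "p i = sum l {0..<i} - sum l {i..<0}" for i
  have p0: "p 0 = 0" by (simp add: p_def)
  have step: "p (i + 1) = p i + l i" for i
  proof (cases "i \<ge> 0")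
    case True
    then have "{0..<i + 1} = insert i {0..<i}" by auto
    with True show ?thesis by (simp add: p_def)
  next
    case False
    then have "{i..<0} = insert i {i + 1..<0}" by auto
    with False show ?thesis by (simp add: p_def)
  qed
  have mono: "p i \<le> p j" if "i \<le> j" for i j
    using that
  proof (induction rule: int_ge_induct)
    case (step j)
    then show ?case using \<open>p (j + 1) = p j + l j\<close> by (simp add: l_def)
  qed simp
  \<comment> \<open>Induction outwards from 0: blocks are nonempty, so a move by one position
    changes the block index by at most one.\<close>
  have "\<exists>i. p i \<le> t \<and> t < p (i + 1)" for t
  proof (induction t rule: int_induct[where k = 0])
    case base
    show ?case using p0 step[of 0] by (intro exI[of _ 0]) (simp add: l_def)
  next
    case (step1 t)
    then obtain i where i: "p i \<le> t" "t < p (i + 1)" by blast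
    show ?case
    proof (cases "t + 1 < p (i + 1)")
      case True
      then show ?thesis using i by (intro exI[of _ i]) simp
    next
      case False
      then show ?thesis using i step[of "i + 1"] by (intro exI[of _ "i + 1"]) (simp add: l_def)
    qed
  next
    case (step2 t)
    then obtain i where i: "p i \<le> t" "t < p (i + 1)" by blast
    show ?case
    proof (cases "p i \<le> t - 1")
      case True
      then show ?thesis using i by (intro exI[of _ i]) simp
    next
      case False
      then show ?thesis using i step[of "i - 1"] by (intro exI[of _ "i - 1"]) (simp add: l_def)
    qed
  qed
  then obtain I where I: "\<And>t. p (I t) \<le> t \<and> t < p (I t + 1)" by metis
  have uniq: "I t = i" if "p i \<le> t" "t < p (i + 1)" for i t
    using that I[of t] mono[of "i + 1" "I t"] mono[of "I t + 1" i] by linarith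
  define x where "x t = (0 # u (I t)) ! nat (t - p (I t))" for t
  have "map x [p i..p (i + 1) - 1] = 0 # u i" for i
  proof (rule nth_equalityI)
    show len: "length (map x [p i..p (i + 1) - 1]) = length (0 # u i)"
      using step[of i] by (simp add: l_def)
    fix k assume k: "k < length (map x [p i..p (i + 1) - 1])"
    then have "p i + int k \<le> p (i + 1) - 1" by simp
    then show "map x [p i..p (i + 1) - 1] ! k = (0 # u i) ! k"
      using k uniq[of i "p i + int k"] by (simp add: x_def nth_upto)
  qed
  moreover have "p i \<le> p (i + 1)" for i using mono by simp
  ultimately show ?thesis using that by blast
qed

lemma block_words_imp_concat:
  "v \<in> block_words w S \<Longrightarrow>
    \<exists>us. v = concat (map (Cons 0) us) \<and> (\<forall>u\<in>set us. appears u w \<and> length u \<in> S)"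
proof (induction rule: block_words.induct)
  case Nil
  show ?case by (intro exI[of _ "[]"]) simp
next
  case (Cons u v)
  then obtain us where us: "v = concat (map (Cons 0) us)" "\<forall>u\<in>set us. appears u w \<and> length u \<in> S"
    by blast
  then show ?case using Cons by (intro exI[of _ "u # us"]) simp
qed

lemma block_words_len_subset_language:
  assumes "S \<noteq> {}"
  shows "block_words_len w S n \<subseteq> language n (gap_concatenations w S)"
proof
  fix v assume "v \<in> block_words_len w S n"
  then have v: "v \<in> block_words w S" "length v = n" by (auto simp: block_words_len_def)
  obtain us where us: "v = concat (map (Cons 0) us)"
    and good: "\<And>u. u \<in> set us \<Longrightarrow> appears u w \<and> length u \<in> S"
    using block_words_imp_concat[OF v(1)] by blast
  obtain u0 where u0: "appears u0 w" "length u0 \<in> S"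
  proof -
    obtain m where "m \<in> S" using assms by auto
    moreover obtain u0 where "length u0 = m" "appears u0 w"
      using appears_ex_length[of m w] by (elim exE conjE)
    ultimately show ?thesis by (intro that[of u0]) simp_all
  qed
  \<comment> \<open>The blocks of \<open>v\<close> take the indices from 0 on, and an admissible
    word \<open>u0\<close>, available because \<open>S\<close> is nonempty, pads both sides.\<close>
  define u where "u i = (if 0 \<le> i \<and> i < int (length us) then us ! nat i else u0)" for i
  obtain p x where p: "\<And>i. p i \<le> p (i + 1)" and x: "\<And>i. map x [p i..p (i + 1) - 1] = 0 # u i"
    by (rule ex_tiling[of u], rule that)
  have "appears (u i) w \<and> length (u i) \<in> S" for i
    using good u0 by (auto simp: u_def)
  then have xX: "x \<in> gap_concatenations w S"
    unfolding gap_concatenations_def mem_Collect_eq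
    using x by (intro exI[of _ u] exI[of _ p]) simp
  have window: "p 0 \<le> p (int m) \<and> map x [p 0..p (int m) - 1] = concat (map (\<lambda>i. 0 # u (int i)) [0..<m])" for m
  proof (induction m)
    case (Suc m)
    have "[p 0..p (int m + 1) - 1] = [p 0..p (int m) - 1] @ [p (int m)..p (int m + 1) - 1]"
      using Suc p[of "int m"] by (intro upto_split_at) auto
    then show ?case using Suc p[of "int m"] x[of "int m"] by (simp add: add.commute)
  qed simp
  have "map (\<lambda>i. 0 # u (int i)) [0..<length us] = map (Cons 0) us"
    by (rule nth_equalityI) (auto simp: u_def)
  then have "v = map x [p 0..p (int (length us)) - 1]"
    using us window[of "length us"] by simp
  then have "appears v x" unfolding appears_def by (intro exI)
  then show "v \<in> language n (gap_concatenations w S)"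
    unfolding language_def using v(2) xX by auto
qed

text \<open>Even the empty word lies in a language only if there is a point, so length 0
  suffices.\<close>

lemma gap_concatenations_nonempty: "S \<noteq> {} \<Longrightarrow> gap_concatenations w S \<noteq> {}"
  using block_words_len_subset_language[of S w 0] by (auto simp: block_words_len_0 language_def)

section \<open>Counting factors of block words\<close>

text \<open>Contains every factor of a gap word. For finite \<open>S\<close> the length condition
  leaves only finitely many lengths; for infinite \<open>S\<close> it always holds.\<close>

definition block_pieces :: "(int \<Rightarrow> nat) \<Rightarrow> nat set \<Rightarrow> nat \<Rightarrow> nat list set" where
  "block_pieces w S n = {u \<in> language n {w}. \<exists>m\<in>S. n \<le> m}"

definition block_prefixes :: "(int \<Rightarrow> nat) \<Rightarrow> nat set \<Rightarrow> nat \<Rightarrow> nat list set" where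
  "block_prefixes w S n = {y. length y = n \<and> (\<exists>b. y @ b \<in> block_words w S)}"

lemma mem_block_pieces_iff:
  "u \<in> block_pieces w S n \<longleftrightarrow> length u = n \<and> appears u w \<and> (\<exists>m\<in>S. n \<le> m)"
  by (auto simp: block_pieces_def language_def)

text \<open>The end of \<open>y\<close> falls either on a block boundary or inside a block, of which
  the zero and an initial part \<open>t\<close> of the gap word then close \<open>y\<close>.\<close>

lemma block_words_prefix:
  assumes "q \<in> block_words w S" "q = y @ b"
  shows "y \<in> block_words w S \<or>
    (\<exists>v t. y = v @ 0 # t \<and> v \<in> block_words w S \<and> t \<in> block_pieces w S (length t))"
  using assms
proof (induction arbitrary: y b rule: block_words.induct)
  case Nil
  then show ?case by (auto intro: block_words.Nil)
next
  case (Cons u v)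
  show ?case
  proof (cases y)
    case Nil
    then show ?thesis by (auto intro: block_words.Nil)
  next
    case (Cons c y')
    then have c: "c = 0" and "u @ v = y' @ b" using Cons.prems by auto
    then consider us where "u = y' @ us" | us where "y' = u @ us" "v = us @ b"
      by (auto simp: append_eq_append_conv2)
    then show ?thesis
    proof cases
      case 1
      then have "y' \<in> block_pieces w S (length y')"
        using Cons.hyps(1,2) appears_append(1)[of y' us w]
        unfolding mem_block_pieces_iff by (auto intro!: bexI[of _ "length u"])
      then show ?thesis using Cons c
        by (intro disjI2 exI[of _ "[]"] exI[of _ y']) (simp add: block_words.Nil)
    next
      case 2
      from Cons.IH[OF 2(2)] show ?thesis
      proof (elim disjE exE conjE)
        assume "us \<in> block_words w S"
        then have "0 # u @ us \<in> block_words w S" using Cons.hyps by (intro block_words.Cons)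
        then show ?thesis using Cons c 2 by simp
      next
        fix v' t assume *: "us = v' @ 0 # t" "v' \<in> block_words w S" "t \<in> block_pieces w S (length t)"
        then have "0 # u @ v' \<in> block_words w S" using Cons.hyps by (intro block_words.Cons)
        then show ?thesis using Cons c 2 *
          by (intro disjI2 exI[of _ "0 # u @ v'"] exI[of _ t]) simp
      qed
    qed
  qed
qed

text \<open>If the left end of \<open>z\<close> cuts a block, the rest of that block is
  \<open>s\<close>, and \<open>y\<close> starts at the next boundary. If \<open>z\<close> also ends
  in that block, \<open>y\<close> is empty; if \<open>z\<close> starts at a boundary,
  \<open>s\<close> is empty, which is a piece because \<open>S\<close> is nonempty.\<close>

lemma block_words_factor:
  assumes "q \<in> block_words w S" "q = a @ z @ b" and S: "S \<noteq> {}"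
  shows "\<exists>s y. z = s @ y \<and> s \<in> block_pieces w S (length s) \<and> y \<in> block_prefixes w S (length y)"
  using assms(1,2)
proof (induction arbitrary: a rule: block_words.induct)
  have Nil_piece: "[] \<in> block_pieces w S (length [])"
    using S by (auto simp: mem_block_pieces_iff)
  have Nil_prefix: "[] \<in> block_prefixes w S (length [])"
    by (auto simp: block_prefixes_def intro!: exI[of _ "[]"] block_words.Nil)
  {
    case Nil
    then show ?case using Nil_piece Nil_prefix by (intro exI[of _ "[]"]) simp
  next
    case (Cons u v)
    show ?case
    proof (cases a)
      case Nil
      then have "z @ b \<in> block_words w S"
        using Cons.hyps Cons.prems block_words.Cons[of u w S v] by simp
      then have "z \<in> block_prefixes w S (length z)"
        by (auto simp: block_prefixes_def)
      then show ?thesis using Nil_piece by (intro exI[of _ "[]"] exI[of _ z]) simp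
    next
      case (Cons c a')
      then have "u @ v = a' @ z @ b" using Cons.prems by auto
      then consider us where "u = a' @ us" "us @ v = z @ b" | us where "v = us @ z @ b"
        by (auto simp: append_eq_append_conv2)
      then show ?thesis
      proof cases
        case 1
        have us: "appears us w" using Cons.hyps(1) 1(1) appears_append(2) by blast
        from 1(2) consider us' where "us = z @ us'" | us' where "z = us @ us'" "v = us' @ b"
          by (auto simp: append_eq_append_conv2)
        then show ?thesis
        proof cases
          case (1 us')
          then have "z \<in> block_pieces w S (length z)"
            using us appears_append(1)[of z us' w] Cons.hyps(2) \<open>u = a' @ us\<close>
            unfolding mem_block_pieces_iff by (auto intro!: bexI[of _ "length u"])
          then show ?thesis using Nil_prefix by (intro exI[of _ z] exI[of _ "[]"]) simp
        next
          case (2 us')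
          have "us \<in> block_pieces w S (length us)"
            using us Cons.hyps(2) \<open>u = a' @ us\<close>
            unfolding mem_block_pieces_iff by (auto intro!: bexI[of _ "length u"])
          moreover have "us' \<in> block_prefixes w S (length us')"
            using 2(2) Cons.hyps(3) by (auto simp: block_prefixes_def)
          ultimately show ?thesis using 2(1) by (intro exI[of _ us] exI[of _ us']) simp
        qed
      next
        case (2 us)
        then show ?thesis by (rule Cons.IH)
      qed
    qed
  }
qed

lemma card_UN_image_Times_le:
  assumes "finite I" "\<And>i. i \<in> I \<Longrightarrow> finite (A i)" "\<And>i. i \<in> I \<Longrightarrow> finite (B i)"
  shows "card (\<Union>i\<in>I. f i ` (A i \<times> B i)) \<le> (\<Sum>i\<in>I. card (A i) * card (B i))"
proof -
  have "card (\<Union>i\<in>I. f i ` (A i \<times> B i)) \<le> (\<Sum>i\<in>I. card (f i ` (A i \<times> B i)))"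
    by (rule card_UN_le[OF assms(1)])
  also have "\<dots> \<le> (\<Sum>i\<in>I. card (A i) * card (B i))"
    using assms by (intro sum_mono) (metis card_cartesian_product card_image_le finite_cartesian_product)
  finally show ?thesis .
qed

text \<open>The weight \<open>z ^ N\<close> is shared between the two factors. Allowing
  \<open>l i + r i < N\<close> leaves room for a separating zero, at no cost since
  \<open>z \<le> 1\<close>.\<close>

lemma card_UN_image_Times_weight_le:
  fixes z :: real
  assumes I: "finite I" "\<And>i. i \<in> I \<Longrightarrow> finite (A i)" "\<And>i. i \<in> I \<Longrightarrow> finite (B i)"
    and z: "0 \<le> z" and bd: "\<And>i. i \<in> I \<Longrightarrow> l i + r i \<le> N"
    and z1: "z \<le> 1"
    and A: "\<And>i. i \<in> I \<Longrightarrow> real (card (A i)) * z ^ l i \<le> K"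
    and B: "\<And>i. i \<in> I \<Longrightarrow> real (card (B i)) * z ^ r i \<le> M"
  shows "real (card (\<Union>i\<in>I. f i ` (A i \<times> B i))) * z ^ N \<le> real (card I) * (K * M)"
proof -
  have "real (card (\<Union>i\<in>I. f i ` (A i \<times> B i))) * z ^ N
      \<le> real (\<Sum>i\<in>I. card (A i) * card (B i)) * z ^ N"
    using card_UN_image_Times_le[of I A B f] I z by (intro mult_right_mono) (auto simp del: of_nat_sum)
  also have "\<dots> = (\<Sum>i\<in>I. real (card (A i)) * real (card (B i)) * z ^ N)"
    by (simp add: sum_distrib_right)
  also have "\<dots> \<le> (\<Sum>i\<in>I. K * M)"
  proof (rule sum_mono)
    fix i assume i: "i \<in> I"
    have "real (card (A i)) * real (card (B i)) * z ^ N
        \<le> real (card (A i)) * real (card (B i)) * z ^ (l i + r i)"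
      using z z1 bd[OF i] by (intro mult_left_mono power_decreasing) auto
    also have "\<dots> = (real (card (A i)) * z ^ l i) * (real (card (B i)) * z ^ r i)"
      by (simp add: power_add)
    also have "\<dots> \<le> K * M"
      using A[OF i] B[OF i] z by (intro mult_mono) (auto intro: order_trans[rotated])
    finally show "real (card (A i)) * real (card (B i)) * z ^ N \<le> K * M" .
  qed
  finally show ?thesis by simp
qed

text \<open>There are \<open>N + 1\<close> lengths for the piece on the left, each of weighted count
  at most \<open>C\<close>. The block prefix after it has weighted count at most
  \<open>1 + N * C\<close>: 1 for complete block words and \<open>C\<close> for each possible length
  of an unfinished last block.\<close>

lemma card_factors_block_words_le:
  assumes fin: "finite (range w)" and S: "S \<noteq> {}" and z: "0 \<le> z" "z \<le> (1::real)" and C: "C \<ge> 0"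
    and words: "\<And>n. real (card (block_words_len w S n)) * z ^ n \<le> 1"
    and pieces: "\<And>n. real (card (block_pieces w S n)) * z ^ n \<le> C"
  shows "real (card {u. length u = N \<and> (\<exists>a b. a @ u @ b \<in> block_words w S)}) * z ^ N
    \<le> real (N + 1) * (C * (1 + real N * C))"
proof -
  have fin_pieces: "finite (block_pieces w S n)" for n
    using finite_language[of "range w" "{w}" n] fin by (simp add: block_pieces_def)
  note fin_words = finite_block_words_len[OF fin]
  \<comment> \<open>An unfinished last block with \<open>b\<close> letters after its zero leaves
    \<open>n - 1 - b\<close> letters for the complete blocks.\<close>
  have prefixes_subset: "block_prefixes w S n \<subseteq> block_words_len w S n \<union>
    (\<Union>b\<in>{..<n}. (\<lambda>(v, t). v @ 0 # t) ` (block_words_len w S (n - 1 - b) \<times> block_pieces w S b))"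
    (is "_ \<subseteq> ?W \<union> ?U") for n
  proof
    fix y assume y: "y \<in> block_prefixes w S n"
    then obtain b where "y @ b \<in> block_words w S" by (auto simp: block_prefixes_def)
    from block_words_prefix[OF this refl] show "y \<in> ?W \<union> ?U"
    proof (elim disjE exE conjE)
      fix v t assume *: "y = v @ 0 # t" "v \<in> block_words w S" "t \<in> block_pieces w S (length t)"
      then have "length t < n" "length v = n - 1 - length t"
        using y by (auto simp: block_prefixes_def)
      with * have "y \<in> (\<lambda>(v, t). v @ 0 # t) ` (block_words_len w S (n - 1 - length t) \<times> block_pieces w S (length t))"
        by (intro image_eqI[of _ _ "(v, t)"]) (auto simp: block_words_len_def)
      then show ?thesis using \<open>length t < n\<close> by blast
    qed (use y in \<open>auto simp: block_words_len_def block_prefixes_def\<close>)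
  qed
  have fin_prefixes: "finite (block_prefixes w S n)" for n
    by (rule finite_subset[OF prefixes_subset]) (use fin_words fin_pieces in auto)
  have prefixes: "real (card (block_prefixes w S n)) * z ^ n \<le> 1 + real n * C" for n
  proof -
    let ?U = "\<Union>b\<in>{..<n}. (\<lambda>(v, t). v @ 0 # t) ` (block_words_len w S (n - 1 - b) \<times> block_pieces w S b)"
    have "card (block_prefixes w S n) \<le> card (block_words_len w S n \<union> ?U)"
      by (rule card_mono[OF _ prefixes_subset]) (use fin_words fin_pieces in auto)
    also have "\<dots> \<le> card (block_words_len w S n) + card ?U" by (rule card_Un_le)
    finally have "real (card (block_prefixes w S n)) * z ^ n
        \<le> real (card (block_words_len w S n) + card ?U) * z ^ n"
      using z by (intro mult_right_mono) auto
    also have "\<dots> = real (card (block_words_len w S n)) * z ^ n + real (card ?U) * z ^ n"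
      by (simp add: algebra_simps)
    also have "real (card ?U) * z ^ n \<le> real (card {..<n}) * (1 * C)"
      by (rule card_UN_image_Times_weight_le[where l = "\<lambda>b. n - 1 - b" and r = "\<lambda>b. b"])
         (use z words pieces fin_words fin_pieces in auto)
    finally show ?thesis using words[of n] by simp
  qed
  let ?L = "{u. length u = N \<and> (\<exists>a b. a @ u @ b \<in> block_words w S)}"
  let ?V = "\<Union>a\<in>{..N}. (\<lambda>(s, y). s @ y) ` (block_pieces w S a \<times> block_prefixes w S (N - a))"
  have "?L \<subseteq> ?V"
  proof
    fix u assume "u \<in> ?L"
    then obtain a b where u: "length u = N" "a @ u @ b \<in> block_words w S" by auto
    from block_words_factor[OF u(2) refl S] obtain s y where
      *: "u = s @ y" "s \<in> block_pieces w S (length s)" "y \<in> block_prefixes w S (length y)" by auto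
    then have "length s \<le> N" "length y = N - length s" using u(1) by auto
    with * have "u \<in> (\<lambda>(s, y). s @ y) ` (block_pieces w S (length s) \<times> block_prefixes w S (N - length s))"
      by (intro image_eqI[of _ _ "(s, y)"]) auto
    then show "u \<in> ?V" using \<open>length s \<le> N\<close> by blast
  qed
  then have "card ?L \<le> card ?V"
    by (rule card_mono[rotated]) (use fin_pieces fin_prefixes in auto)
  then have "real (card ?L) * z ^ N \<le> real (card ?V) * z ^ N"
    using z by (intro mult_right_mono) auto
  also have "\<dots> \<le> real (card {..N}) * (C * (1 + real N * C))"
  proof (rule card_UN_image_Times_weight_le[where l = "\<lambda>a. a" and r = "\<lambda>a. N - a"])
    fix a assume "a \<in> {..N}"
    have "1 + real (N - a) * C \<le> 1 + real N * C" using C by (intro add_left_mono mult_right_mono) auto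
    with prefixes[of "N - a"]
    show "real (card (block_prefixes w S (N - a))) * z ^ (N - a) \<le> 1 + real N * C" by linarith
  qed (use z pieces fin_pieces fin_prefixes in auto)
  finally show ?thesis by simp
qed

section \<open>Renewal argument and the value of the entropy\<close>

text \<open>A summable solution with total mass \<open>T\<close> would satisfy \<open>T = 1 + T\<close> by the Cauchy product.\<close>

lemma renewal_sequence:
  fixes d \<alpha> :: "nat \<Rightarrow> real"
  assumes d: "d 0 = 1" "\<And>n. d (Suc n) = (\<Sum>i\<le>n. \<alpha> i * d (n - i))"
    and \<alpha>: "\<And>i. \<alpha> i \<ge> 0" "\<alpha> sums 1"
  shows "0 \<le> d n \<and> d n \<le> 1" "\<not> summable d"
proof -
  show bounds: "0 \<le> d n \<and> d n \<le> 1" for n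
  proof (induction n rule: less_induct)
    case (less n)
    show ?case
    proof (cases n)
      case (Suc m)
      have "(\<Sum>i\<le>m. \<alpha> i * d (m - i)) \<le> (\<Sum>i\<le>m. \<alpha> i)"
        using less \<alpha>(1) Suc by (intro sum_mono mult_left_le) auto
      also have "\<dots> \<le> 1"
        using sum_le_suminf[of \<alpha> "{..m}"] \<alpha> by (auto simp: sums_iff)
      finally show ?thesis
        using less \<alpha>(1) Suc by (auto simp: d(2) intro!: sum_nonneg)
    qed (use d(1) in simp)
  qed
  show "\<not> summable d"
  proof
    assume sd: "summable d"
    have "(\<lambda>n. \<Sum>i\<le>n. \<alpha> i * d (n - i)) sums ((\<Sum>i. \<alpha> i) * (\<Sum>i. d i))"
      using sd \<alpha> bounds by (intro Cauchy_product_sums) (auto simp: sums_iff)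
    then have "(\<lambda>n. d (Suc n)) sums (\<Sum>i. d i)"
      using \<alpha>(2) by (simp add: d(2) sums_iff)
    then have "(\<Sum>i. d i) = (\<Sum>i. d i) - d 0"
      using suminf_split_head[OF sd] by (simp add: sums_iff)
    then show False using d(1) by simp
  qed
qed

lemma polynomial_bounds_exponential_imp_le_1:
  fixes x :: real
  assumes "x \<ge> 0" "C \<ge> 0" "\<And>n. x ^ n \<le> real (n + 1) * (C * (1 + real n * C))"
  shows "x \<le> 1"
proof (rule ccontr)
  assume "\<not> x \<le> 1"
  then have "x > 1" by simp
  then have "(\<lambda>n. real (n + 1) * (C * (1 + real n * C)) / x ^ n) \<longlonglongrightarrow> 0"
    using \<open>C \<ge> 0\<close> by real_asymp
  then have "\<forall>\<^sub>F n in sequentially. real (n + 1) * (C * (1 + real n * C)) / x ^ n < 1"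
    by (rule order_tendstoD(2)) simp
  then obtain n where "real (n + 1) * (C * (1 + real n * C)) / x ^ n < 1"
    using eventually_happens'[OF sequentially_bot] by blast
  then show False using \<open>x > 1\<close> assms(3)[of n] by (simp add: field_simps)
qed

text \<open>Here \<open>z\<close> is the reciprocal of \<lambda>. The growth rate \<open>H\<close>
  of the language is found by excluding both \<open>H * z > 1\<close> and
  \<open>H * z < 1\<close>.\<close>

lemma gap_shift_entropy:
  assumes fin: "finite (range w)" and nz: "0 \<notin> range w" and S: "S \<noteq> {}"
    and G: "\<And>r. r > G \<Longrightarrow> \<exists>C>0. \<forall>n. real (complexity w n) \<le> C * r ^ n"
    and z: "0 < z" "infinite S \<Longrightarrow> G * z < 1"
    and eq: "(\<lambda>n. (if n \<in> S then real (complexity w n) else 0) * z ^ Suc n) sums 1"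
  shows "has_entropy (gap_shift w S) (ln (1 / z))"
proof -
  let ?X = "gap_concatenations w S"
  \<comment> \<open>Each letter weighs \<open>z\<close>: \<open>\<alpha> n\<close> is the weighted
    number of blocks with gap length \<open>n\<close>, hence the exponent \<open>Suc n\<close>, and
    \<open>d n\<close> that of block words of length \<open>n\<close>.\<close>
  define \<alpha> where "\<alpha> n = (if n \<in> S then real (complexity w n) else 0) * z ^ Suc n" for n
  define d where "d n = real (card (block_words_len w S n)) * z ^ n" for n
  have cpos: "1 \<le> complexity w n" for n
    using language_nonempty[of "{w}" n] finite_language[of "range w" "{w}" n] fin
    by (simp add: complexity_eq_card_language Suc_le_eq card_gt_0_iff)
  have \<alpha>: "\<alpha> n \<ge> 0" "\<alpha> sums 1" for n
    using z(1) eq unfolding \<alpha>_def by simp_all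
  have d0: "d 0 = 1" by (simp add: d_def block_words_len_0)
  have dSuc: "d (Suc n) = (\<Sum>i\<le>n. \<alpha> i * d (n - i))" for n
  proof -
    have "d (Suc n) = (\<Sum>i\<in>{i\<in>S. i \<le> n}.
        real (complexity w i) * real (card (block_words_len w S (n - i))) * z ^ Suc n)"
      by (simp add: d_def card_block_words_len_Suc[OF fin nz] sum_distrib_right)
    also have "\<dots> = (\<Sum>i\<in>{i\<in>S. i \<le> n}. \<alpha> i * d (n - i))"
    proof (rule sum.cong)
      fix i assume "i \<in> {i\<in>S. i \<le> n}"
      moreover from this have "z ^ Suc n = z ^ Suc i * z ^ (n - i)"
        by (simp flip: power_add)
      ultimately show "real (complexity w i) * real (card (block_words_len w S (n - i))) * z ^ Suc n
          = \<alpha> i * d (n - i)"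
        by (simp add: \<alpha>_def d_def)
    qed simp
    also have "\<dots> = (\<Sum>i\<le>n. \<alpha> i * d (n - i))"
      by (rule sum.mono_neutral_left) (auto simp: \<alpha>_def)
    finally show ?thesis .
  qed
  note renewal = renewal_sequence[of d \<alpha>, OF d0 dSuc \<alpha>]
  obtain m where m: "m \<in> S" using S by auto
  \<comment> \<open>For \<open>z > 1\<close> the single term at \<open>m\<close> would already
    exceed the total 1.\<close>
  have z1: "z \<le> 1"
  proof (rule ccontr)
    assume "\<not> z \<le> 1"
    then have "1 < 1 * z ^ Suc m" using one_less_power[of z "Suc m"] by simp
    also have "1 * z ^ Suc m \<le> real (complexity w m) * z ^ Suc m"
      using cpos[of m] z(1) by (intro mult_right_mono) auto
    finally have "real (complexity w m) * z ^ Suc m > 1" by simp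
    moreover have "\<alpha> m \<le> 1"
      using sum_le_suminf[of \<alpha> "{m}"] \<alpha> by (auto simp: sums_iff)
    ultimately show False using m by (simp add: \<alpha>_def)
  qed
  \<comment> \<open>A uniform bound on the weighted piece counts. For finite \<open>S\<close> there
    are no pieces longer than \<open>Max S\<close>; for infinite \<open>S\<close> the rate
    \<open>1 / z\<close> exceeds the growth rate \<open>G\<close> of the complexity.\<close>
  obtain C where C: "C \<ge> 0" "\<And>n. real (card (block_pieces w S n)) * z ^ n \<le> C"
  proof (cases "finite S")
    case True
    define C where "C = (\<Sum>n\<le>Max S. real (card (block_pieces w S n)) * z ^ n)"
    have "C \<ge> 0" unfolding C_def using z by (intro sum_nonneg) auto
    moreover have "real (card (block_pieces w S n)) * z ^ n \<le> C" for n
    proof (cases "n \<le> Max S")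
      case True
      then show ?thesis unfolding C_def using z by (intro member_le_sum) auto
    next
      case False
      then have "block_pieces w S n = {}"
        using Max_ge[OF \<open>finite S\<close>] by (force simp: mem_block_pieces_iff)
      then show ?thesis using \<open>C \<ge> 0\<close> by simp
    qed
    ultimately show ?thesis by (rule that)
  next
    case False
    then have "G < 1 / z" using z by (simp add: field_simps)
    then obtain C where C: "C > 0" "\<And>n. real (complexity w n) \<le> C * (1 / z) ^ n"
      using G by blast
    have "real (card (block_pieces w S n)) * z ^ n \<le> C" for n
    proof -
      have "card (block_pieces w S n) \<le> complexity w n"
        unfolding complexity_eq_card_language block_pieces_def
        using finite_language[of "range w" "{w}" n] fin by (intro card_mono) auto
      then have "real (card (block_pieces w S n)) * z ^ n \<le> C * (1 / z) ^ n * z ^ n"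
        using C(2)[of n] z by (intro mult_right_mono) auto
      then show ?thesis using z by (simp add: power_one_over)
    qed
    then show ?thesis by (rule that[OF less_imp_le[OF C(1)]])
  qed
  have sub: "language n ?X \<subseteq> {u. length u = n \<and> (\<exists>a b. a @ u @ b \<in> block_words w S)}" for n
    unfolding language_def using appears_gap_concatenations_imp_factor[of _ w S] by blast
  have fin_factors: "finite {u. length u = n \<and> (\<exists>a b. a @ u @ b \<in> block_words w S)}" for n
  proof (rule finite_subset[OF _ finite_lists_length_eq])
    show "{u. length u = n \<and> (\<exists>a b. a @ u @ b \<in> block_words w S)}
      \<subseteq> {u. set u \<subseteq> insert 0 (range w) \<and> length u = n}"
      by (auto dest!: block_words_set)
  qed (use fin in simp)
  have finL: "finite (language n ?X)" for n
    using sub fin_factors by (rule finite_subset)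
  obtain H where H: "H \<ge> 1" "has_entropy ?X (ln H)" "\<And>n. H ^ n \<le> real (card (language n ?X))"
    "\<And>r. r > H \<Longrightarrow> \<exists>C>0. \<forall>n. real (card (language n ?X)) \<le> C * r ^ n"
    by (rule language_growth[OF finL gap_concatenations_nonempty[OF S]], rule that) assumption+
  \<comment> \<open>Weighting \<open>H ^ n \<le> card (language n ?X)\<close> by
    \<open>z ^ n\<close> and passing to factors of block words leaves a polynomial bound.\<close>
  have "H * z \<le> 1"
  proof (rule polynomial_bounds_exponential_imp_le_1)
    fix n
    have "(H * z) ^ n \<le> real (card (language n ?X)) * z ^ n"
      using H(3)[of n] z by (simp add: power_mult_distrib)
    also have "\<dots> \<le> real (card {u. length u = n \<and> (\<exists>a b. a @ u @ b \<in> block_words w S)}) * z ^ n"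
      using card_mono[OF fin_factors sub, of n] z by simp
    also have "\<dots> \<le> real (n + 1) * (C * (1 + real n * C))"
      using card_factors_block_words_le[OF fin S _ z1 C(1) _ C(2)] z renewal(1)
      unfolding d_def by simp
    finally show "(H * z) ^ n \<le> real (n + 1) * (C * (1 + real n * C))" .
  qed (use H(1) z C(1) in auto)
  \<comment> \<open>Otherwise a rate \<open>r\<close> between \<open>H\<close> and
    \<open>1 / z\<close> would dominate \<open>d\<close> by a convergent geometric series, since
    block words belong to the language.\<close>
  moreover have "\<not> H * z < 1"
  proof
    assume "H * z < 1"
    then have "H < 1 / z" using z by (simp add: field_simps)
    then obtain r where r: "H < r" "r < 1 / z" using dense by blast
    obtain K where K: "K > 0" "\<And>n. real (card (language n ?X)) \<le> K * r ^ n"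
      using H(4)[OF r(1)] by blast
    have "\<bar>r * z\<bar> < 1" using r z H(1) by (simp add: field_simps abs_mult)
    then have "summable (\<lambda>n. K * (r * z) ^ n)" by (intro summable_mult summable_geometric) simp
    then have "summable d"
    proof (rule summable_comparison_test')
      fix n
      have "real (card (block_words_len w S n)) \<le> K * r ^ n"
        using card_mono[OF finL block_words_len_subset_language[OF S]] K(2)[of n]
        by (meson of_nat_mono order_trans)
      then have "d n \<le> K * r ^ n * z ^ n" unfolding d_def using z by (intro mult_right_mono) auto
      then show "norm (d n) \<le> K * (r * z) ^ n"
        using renewal(1)[of n] by (simp add: power_mult_distrib mult.assoc)
    qed
    with renewal(2) show False by simp
  qed
  ultimately have "H = 1 / z" using z by (simp add: field_simps)
  then show ?thesis
    using H(2) by (simp add: has_entropy_def gap_shift_def language_closure)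
qed

theorem theorem1p1:
  fixes k :: nat and w :: "int \<Rightarrow> nat" and S :: "nat set"
  assumes "k > 0"
    and "range w \<subseteq> {1..k}"
    and "S \<noteq> {}"
  shows "\<exists>l::real. l > 0 \<and>
           (\<forall>m>0. ((\<lambda>n. real (complexity w n) * m powi (- (int n + 1))) has_sum 1) S \<longleftrightarrow> m = l) \<and>
           has_entropy (gap_shift w S) (ln l)"
proof -
  have fin: "finite (range w)" using assms(2) finite_subset by blast
  have nz: "0 \<notin> range w" using subsetD[OF assms(2), of 0] by auto
  have finL: "finite (language n {w})" for n using finite_language[OF fin, of "{w}"] by simp
  \<comment> \<open>\<open>G\<close> is the growth rate of the complexity, obtained by regarding
    \<open>{w}\<close> as a set of points.\<close>
  obtain G where "G \<ge> 1" "\<And>n. G ^ n \<le> real (card (language n {w}))"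
    "\<And>r. r > G \<Longrightarrow> \<exists>C>0. \<forall>n. real (card (language n {w})) \<le> C * r ^ n"
    by (rule language_growth[of "{w}", OF finL insert_not_empty], rule that) assumption+
  note G = this[folded complexity_eq_card_language]
  have c1: "1 \<le> real (complexity w n)" for n
    using G(1) G(2)[of n] one_le_power[of G n] by linarith
  let ?a = "\<lambda>n. if n \<in> S then real (complexity w n) else 0"
  \<comment> \<open>\<open>z\<close> is the reciprocal of the \<lambda> sought.\<close>
  obtain z where z: "0 < z" "infinite S \<Longrightarrow> G * z < 1" and eq: "(\<lambda>n. ?a n * z ^ Suc n) sums 1"
    using entropy_equation_solvable[OF assms(3) c1 G] by blast
  obtain j where j: "j \<in> S" using assms(3) by auto
  have a: "?a n \<ge> 0" "?a j > 0" for n using c1[of j] j by auto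
  \<comment> \<open>Any other solution lies on one side of \<open>z\<close>, and strict monotonicity
    would give \<open>1 < 1\<close>.\<close>
  have uniq: "y = z" if "y > 0" "(\<lambda>n. ?a n * y ^ Suc n) sums 1" for y
    using sums_powers_inj[of ?a j y z 1 1, OF a] sums_powers_inj[of ?a j z y 1 1, OF a] that z(1) eq
    by (cases y z rule: linorder_cases) auto
  have "((\<lambda>n. real (complexity w n) * m powi (- (int n + 1))) has_sum 1) S \<longleftrightarrow> m = 1 / z"
    if "m > 0" for m
  proof -
    have "((\<lambda>n. real (complexity w n) * m powi (- (int n + 1))) has_sum 1) S \<longleftrightarrow>
        (\<lambda>n. ?a n * (1 / m) ^ Suc n) sums 1"
      using that by (intro has_sum_iff_sums_powers) auto
    also have "\<dots> \<longleftrightarrow> 1 / m = z"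
      using uniq[of "1 / m"] eq that by auto
    also have "\<dots> \<longleftrightarrow> m = 1 / z" using that z(1) by (auto simp: field_simps)
    finally show ?thesis .
  qed
  then show ?thesis
    using z(1) gap_shift_entropy[OF fin nz assms(3) G(3) z eq]
    by (intro exI[of _ "1 / z"]) auto
qed

end
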